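(* Let $W$ and $\tilde W$ be weight matrices of size $N$ on $(x_0,x_1)$, and let $\{P_n\}_{n\in\mathbb{N}_0}$ and $\{\tilde P_n\}_{n\in\mathbb{N}_0}$ be sequences of matrix-valued orthogonal polynomials with respect to $W$ and $\tilde W$, respectively. Suppose there exists a differential operator $\mathcal{V}\in \operatorname{Mat}_{N}(\Omega[x])$ such that $$P_{n}(x)\cdot \mathcal{V}=A_{n}\tilde{P}_{n}(x)\quad\text{for all } n\in\mathbb{N}_0,$$ with $A_n\in\operatorname{Mat}_N(\mathbb{C})$ and $A_n$ invertible for some $n$. Then there exists a differential operator $\mathcal{N}\in\operatorname{Mat}_N(\Omega[x])$ such that $$\tilde P_{n}(x)\cdot \mathcal{N}=\tilde A_{n}P_{n}(x)\quad\text{for all } n\in\mathbb{N}_0,$$ with $\tilde A_n\in\operatorname{Mat}_N(\mathbb{C})$ and $\tilde A_n$ invertible for some $n$. In particular, $P_n\cdot\mathcal{V}\mathcal{N}=A_n\tilde A_nP_n$ and $\tilde P_n\cdot\mathcal{N}\mathcal{V}=\tilde A_nA_n\tilde P_n$ for all $n$, i.e. $\mathcal{V}\mathcal{N}\in\mathcal{D}(W)$ and $\mathcal{N}\mathcal{V}\in\mathcal{D}(\tilde W)$. Furthermore, $\mathcal{N}=\tilde W\mathcal{V}^*W^{-1}$.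
   Context: Fix a possibly infinite interval $(x_0,x_1)$ of the real line. A weight matrix of size $N$ is a complex $N\times N$ matrix-valued smooth function $W$ on $(x_0,x_1)$ that is positive definite almost everywhere and has finite moments of all orders. For $P,Q\in\operatorname{Mat}_N(\mathbb{C}[x])$ put $\langle P,Q\rangle_W=\int_{x_0}^{x_1}P(x)W(x)Q(x)^*\,dx$, where $*$ is the Hermitian conjugate. A sequence of matrix-valued orthogonal polynomials with respect to $W$ is a sequence $\{P_n\}_{n\in\mathbb{N}_0}$ in $\operatorname{Mat}_N(\mathbb{C}[x])$, $\mathbb{N}_0=\{0,1,\dots\}$, with $P_n$ of degree $n$ with nonsingular leading coefficient and $\langle P_n,P_m\rangle_W=0$ for $n\ne m$. Differential operators $D=\sum_{i=0}^s\partial^iF_i(x)$, $\partial=\frac{d}{dx}$, act on the right: $(P\cdot D)(x)=\sum_{i=0}^s\frac{d^iP}{dx^i}(x)F_i(x)$, and $P\cdot(DE)=(P\cdot D)\cdot E$. $\operatorname{Mat}_N(\Omega[x])$ is the algebra of such operators with $F_i\in\operatorname{Mat}_N(\mathbb{C}[x])$. $\mathcal{D}(W)$ is the set of $D\in\operatorname{Mat}_N(\Omega[x])$ such that, for every $n\in\mathbb{N}_0$, $P_n\cdot D=\Lambda_n(D)P_n$ for some $\Lambda_n(D)\in\operatorname{Mat}_N(\mathbb{C})$ (this does not depend on the chosen orthogonal sequence $\{P_n\}$ for $W$). For $\mathcal V=\sum_j\partial^jF_j$, the formal adjoint is $\mathcal V^*=\sum_jF_j(x)^*(-1)^j\partial^j$;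 thus $Q\cdot(\tilde W\mathcal V^*W^{-1})=\sum_j(-1)^j\frac{d^j}{dx^j}\big(Q\tilde WF_j^*\big)\,W^{-1}$. Standing assumption on weights: all weight matrices considered (including direct sums $W\oplus\tilde W$ of the weights considered, i.e. block diagonal matrices) are "good enough" in the following sense, written for a weight $W$ of size $N$: if $D\in\operatorname{Mat}_N(\Omega[x])$ and $A\in\operatorname{Mat}_N(\mathbb{C}[x])$ satisfy $\int_{x_0}^{x_1}PAW\,dx=\int_{x_0}^{x_1}P\,(W\cdot D)\,dx$ for all $P\in\operatorname{Mat}_N(\mathbb{C}[x])$, then $AW=W\cdot D$. In particular, whenever $D,\tilde D\in\operatorname{Mat}_N(\Omega[x])$ satisfy $\langle P\cdot D,Q\rangle_W=\langle P,Q\cdot\tilde D\rangle_W$ for all $P,Q\in\operatorname{Mat}_N(\mathbb{C}[x])$, one has $\tilde D=WD^*W^{-1}$. *)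

theory Defs
  imports "HOL-Analysis.Analysis" "HOL-Computational_Algebra.Polynomial"
begin

text \<open>
  Square matrices over a ring are written \<open>'a^'n^'n\<close>, with product \<open>**\<close>. Beware that \<open>*\<close> on
  this type is the entrywise product; it is not used below.
\<close>

section \<open>Matrix-valued polynomials\<close>

type_synonym 'n mpoly = "complex poly^'n^'n"

definition mconst :: "complex^'n^'n \<Rightarrow> ('n::finite) mpoly" where
  "mconst A = map_matrix (\<lambda>c. [:c:]) A"

definition meval :: "('n::finite) mpoly \<Rightarrow> real \<Rightarrow> complex^'n^'n" where
  "meval P x = map_matrix (\<lambda>p. poly p (of_real x)) P"

definition mderiv :: "nat \<Rightarrow> ('n::finite) mpoly \<Rightarrow> 'n mpoly" where
  "mderiv k P = map_matrix (pderiv ^^ k) P"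

definition mcoeff :: "('n::finite) mpoly \<Rightarrow> nat \<Rightarrow> complex^'n^'n" where
  "mcoeff P k = map_matrix (\<lambda>p. coeff p k) P"

definition ctranspose :: "complex^'n^'m \<Rightarrow> complex^'m^'n" where
  "ctranspose M = map_matrix cnj (transpose M)"


section \<open>Differential operators acting on the right\<close>

text \<open>
  The operator \<open>\<Sum>\<^sub>i \<partial>\<^sup>i F\<^sub>i\<close> is represented by its coefficient sequence \<open>F\<^sub>i\<close>, stored as a
  polynomial in the symbol \<open>\<partial>\<close>. Only the additive structure of this polynomial type is
  meaningful here; composition of operators is \<open>dop_mult\<close>.
\<close>

type_synonym 'n dop = "'n mpoly poly"

definition act :: "('n::finite) mpoly \<Rightarrow> 'n dop \<Rightarrow> 'n mpoly" where
  "act P D = (\<Sum>i\<le>degree D. mderiv i P ** coeff D i)"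

text \<open>
  The product \<open>D E\<close> means first \<open>D\<close>, then \<open>E\<close>. By the Leibniz rule,
  \<open>\<partial>\<^sup>i F \<partial>\<^sup>j G = \<Sum>\<^sub>k (j choose k) \<partial>\<^bsup>i+j-k\<^esup> F\<^bsup>(k)\<^esup> G\<close>; see \<open>act_dop_mult\<close>.
\<close>

definition dop_mult :: "('n::finite) dop \<Rightarrow> 'n dop \<Rightarrow> 'n dop" where
  "dop_mult D E = (\<Sum>i\<le>degree D. \<Sum>j\<le>degree E. \<Sum>k\<le>j.
     monom (map_matrix (smult (of_nat (j choose k))) (mderiv k (coeff D i) ** coeff E j))
           (i + j - k))"

lemma act_upto:
  assumes "degree D \<le> m"
  shows "act P D = (\<Sum>i\<le>m. mderiv i P ** coeff D i)"
  unfolding act_def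
proof (rule sum.mono_neutral_left)
  show "\<forall>i\<in>{..m} - {..degree D}. mderiv i P ** coeff D i = 0"
    by (auto simp: coeff_eq_0)
qed (use assms in auto)

lemma act_add: "act P (D + E) = act P D + act P E"
proof -
  let ?m = "max (degree D) (degree E)"
  have "degree (D + E) \<le> ?m" by (rule degree_add_le_max)
  then show ?thesis
    by (simp add: act_upto[of _ ?m] matrix_add_ldistrib sum.distrib)
qed

lemma act_0 [simp]: "act P 0 = 0"
  by (simp add: act_def)

lemma act_sum: "act P (sum f A) = (\<Sum>a\<in>A. act P (f a))"
  by (induction A rule: infinite_finite_induct) (auto simp: act_add)

lemma act_monom: "act P (monom F i) = mderiv i P ** F"
proof -
  have "act P (monom F i) = (\<Sum>j\<le>i. mderiv j P ** coeff (monom F i) j)"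
    by (rule act_upto) (rule degree_monom_le)
  also have "\<dots> = (\<Sum>j\<le>i. if j = i then mderiv i P ** F else 0)"
    by (rule sum.cong) auto
  finally show ?thesis by simp
qed

lemma mderiv_0 [simp]: "mderiv 0 P = P"
  by (simp add: mderiv_def vec_eq_iff)

lemma mderiv_mderiv: "mderiv i (mderiv j P) = mderiv (i + j) P"
  by (simp add: mderiv_def vec_eq_iff funpow_add)

lemma mderiv_sum: "mderiv j (sum f A) = (\<Sum>a\<in>A. mderiv j (f a))"
  by (simp add: mderiv_def vec_eq_iff sum_component higher_pderiv_sum)

lemma smult_sum_right: "smult c (sum f A) = (\<Sum>a\<in>A. smult c (f a))"
  by (induction A rule: infinite_finite_induct) (auto simp: smult_add_right)

lemma pderiv_sum_complex:
  fixes f :: "'a \<Rightarrow> complex poly"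
  shows "pderiv (sum f A) = (\<Sum>a\<in>A. pderiv (f a))"
  using higher_pderiv_sum[of 1 f A] by simp

lemma higher_pderiv_mult:
  fixes p q :: "complex poly"
  shows "(pderiv ^^ j) (p * q)
       = (\<Sum>k\<le>j. smult (of_nat (j choose k)) ((pderiv ^^ (j - k)) p * (pderiv ^^ k) q))"
proof (induction j)
  case (Suc j)
  let ?t = "\<lambda>a b. (pderiv ^^ a) p * (pderiv ^^ b) q"
  let ?c = "\<lambda>k. of_nat (j choose k) :: complex"
  have "(pderiv ^^ Suc j) (p * q) = (\<Sum>k\<le>j. smult (?c k) (pderiv (?t (j - k) k)))"
    by (simp add: Suc pderiv_sum_complex pderiv_smult)
  also have "\<dots> = (\<Sum>k\<le>j. smult (?c k) (?t (Suc j - k) k))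
                 + (\<Sum>k\<le>j. smult (?c k) (?t (j - k) (Suc k)))"
    unfolding sum.distrib[symmetric]
    by (intro sum.cong refl) (simp add: pderiv_mult Suc_diff_le smult_add_right algebra_simps)
  also have "(\<Sum>k\<le>j. smult (?c k) (?t (Suc j - k) k))
      = (\<Sum>k\<le>Suc j. smult (?c k) (?t (Suc j - k) k))"
    by (simp add: binomial_eq_0)
  also have "\<dots> = ?t (Suc j) 0 + (\<Sum>k\<le>j. smult (?c (Suc k)) (?t (j - k) (Suc k)))"
    by (subst sum.atMost_Suc_shift) simp
  finally have "(pderiv ^^ Suc j) (p * q) = ?t (Suc j) 0
      + (\<Sum>k\<le>j. smult (of_nat (Suc j choose Suc k)) (?t (j - k) (Suc k)))"
    by (simp add: sum.distrib[symmetric] smult_add_left add_ac del: funpow.simps)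
  then show ?case
    by (subst sum.atMost_Suc_shift) (simp del: funpow.simps binomial_Suc_Suc)
qed simp

lemma mderiv_mult:
  "mderiv j (A ** B) = (\<Sum>k\<le>j. map_matrix (smult (of_nat (j choose k)))
     (mderiv (j - k) A ** mderiv k B))"
  by (simp add: vec_eq_iff mderiv_def matrix_matrix_mult_def sum_component higher_pderiv_sum
      higher_pderiv_mult smult_sum_right sum.swap[of _ UNIV])

lemma smult_matrix_mult:
  fixes A B :: "('n::finite) mpoly"
  shows "map_matrix (smult c) A ** B = map_matrix (smult c) (A ** B)"
    and "A ** map_matrix (smult c) B = map_matrix (smult c) (A ** B)"
  by (simp_all add: vec_eq_iff matrix_matrix_mult_def smult_sum_right)

lemma sum_matrix_mult:
  fixes B :: "('n::finite) mpoly"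
  shows "sum f S ** B = (\<Sum>s\<in>S. f s ** B)"
  by (induction S rule: infinite_finite_induct) 
    (auto simp: vec_eq_iff matrix_matrix_mult_def distrib_right sum.distrib)

lemma act_dop_mult: "act P (dop_mult D E) = act (act P D) E"
proof -
  have "act (act P D) E = (\<Sum>j\<le>degree E. \<Sum>i\<le>degree D. mderiv j (mderiv i P ** coeff D i) ** coeff E j)"
    unfolding act_def[of "act P D"] unfolding act_def[of P D] mderiv_sum sum_matrix_mult ..
  also have "\<dots> = (\<Sum>i\<le>degree D. \<Sum>j\<le>degree E. mderiv j (mderiv i P ** coeff D i) ** coeff E j)"
    by (rule sum.swap)
  also have "\<dots> = act P (dop_mult D E)"
    unfolding dop_mult_def act_sum act_monom mderiv_mult sum_matrix_mult
    by (intro sum.cong refl)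
      (simp add: smult_matrix_mult mderiv_mderiv matrix_mul_assoc add.commute)
  finally show ?thesis ..
qed


section \<open>Weights and orthogonal polynomials\<close>

definition pos_def :: "complex^'n^'n \<Rightarrow> bool" where
  "pos_def M \<longleftrightarrow> ctranspose M = M \<and>
     (\<forall>v. v \<noteq> 0 \<longrightarrow> Re (\<Sum>i\<in>UNIV. \<Sum>j\<in>UNIV. cnj (v $ i) * M $ i $ j * v $ j) > 0)"

definition vderiv :: "nat \<Rightarrow> (real \<Rightarrow> 'a::real_normed_vector) \<Rightarrow> real \<Rightarrow> 'a" where
  "vderiv k f = ((\<lambda>g x. vector_derivative g (at x)) ^^ k) f"

definition smooth_on_open :: "real set \<Rightarrow> (real \<Rightarrow> 'a::real_normed_vector) \<Rightarrow> bool" where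
  "smooth_on_open S f \<longleftrightarrow> open S \<and> (\<forall>k. \<forall>x\<in>S. vderiv k f differentiable at x)"

text \<open>
  The interval \<open>(x0,x1)\<close> has extended real endpoints. A weight is a function on all of \<open>\<real>\<close>
  whose values outside the interval are irrelevant.
\<close>

definition weight :: "ereal \<Rightarrow> ereal \<Rightarrow> (real \<Rightarrow> complex^'n^'n) \<Rightarrow> bool" where
  "weight x0 x1 W \<longleftrightarrow> x0 < x1 \<and> smooth_on_open (einterval x0 x1) W \<and>
     (AE x in lborel. x \<in> einterval x0 x1 \<longrightarrow> pos_def (W x)) \<and>
     (\<forall>k::nat. set_integrable lborel (einterval x0 x1) (\<lambda>x. x ^ k *\<^sub>R W x))"

definition mint :: "ereal \<Rightarrow> ereal \<Rightarrow> (real \<Rightarrow> complex^'n^'n) \<Rightarrow> complex^'n^'n" where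
  "mint x0 x1 f = set_lebesgue_integral lborel (einterval x0 x1) f"

definition pairing ::
  "ereal \<Rightarrow> ereal \<Rightarrow> (real \<Rightarrow> complex^'n^'n) \<Rightarrow> ('n::finite) mpoly \<Rightarrow> 'n mpoly \<Rightarrow> complex^'n^'n"
  where
  "pairing x0 x1 W P Q = mint x0 x1 (\<lambda>x. meval P x ** W x ** ctranspose (meval Q x))"

definition orthogonal_seq ::
  "ereal \<Rightarrow> ereal \<Rightarrow> (real \<Rightarrow> complex^'n^'n) \<Rightarrow> (nat \<Rightarrow> ('n::finite) mpoly) \<Rightarrow> bool" where
  "orthogonal_seq x0 x1 W P \<longleftrightarrow>
     (\<forall>n. (\<forall>k>n. mcoeff (P n) k = 0) \<and> invertible (mcoeff (P n) n)) \<and>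
     (\<forall>n m. n \<noteq> m \<longrightarrow> pairing x0 x1 W (P n) (P m) = 0)"

text \<open>
  The algebra \<open>\<D>(W)\<close>. Two orthogonal sequences for \<open>W\<close> differ by invertible constant left
  factors, so the condition does not depend on the sequence.
\<close>

definition dop_algebra ::
  "ereal \<Rightarrow> ereal \<Rightarrow> (real \<Rightarrow> complex^'n^'n) \<Rightarrow> ('n::finite) dop set" where
  "dop_algebra x0 x1 W = {D. \<exists>P. orthogonal_seq x0 x1 W P \<and>
     (\<forall>n. \<exists>\<Lambda>. act (P n) D = mconst \<Lambda> ** P n)}"


section \<open>Formal adjoints and the standing assumption on weights\<close>

definition wact :: "(real \<Rightarrow> complex^'n^'n) \<Rightarrow> ('n::finite) dop \<Rightarrow> real \<Rightarrow> complex^'n^'n" where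
  "wact W D x = (\<Sum>i\<le>degree D. vderiv i W x ** meval (coeff D i) x)"

text \<open>
  \<open>adj_act W Wt V Q x\<close> is the value at \<open>x\<close> of \<open>Q \<cdot> (Wt V\<^sup>* W\<^sup>-\<^sup>1)\<close>, meaningful where \<open>W x\<close> is
  invertible. A differential operator with smooth coefficients is determined by its action on
  polynomials, so \<open>is_adjoint\<close> expresses the operator identity \<open>N = Wt V\<^sup>* W\<^sup>-\<^sup>1\<close>.
\<close>

definition adj_act :: "(real \<Rightarrow> complex^'n^'n) \<Rightarrow> (real \<Rightarrow> complex^'n^'n) \<Rightarrow>
    ('n::finite) dop \<Rightarrow> 'n mpoly \<Rightarrow> real \<Rightarrow> complex^'n^'n" where
  "adj_act W Wt V Q x =
     (\<Sum>j\<le>degree V. (-1) ^ j *\<^sub>R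
        vderiv j (\<lambda>t. meval Q t ** Wt t ** ctranspose (meval (coeff V j) t)) x)
     ** matrix_inv (W x)"

definition is_adjoint :: "ereal \<Rightarrow> ereal \<Rightarrow> (real \<Rightarrow> complex^'n^'n) \<Rightarrow>
    (real \<Rightarrow> complex^'n^'n) \<Rightarrow> ('n::finite) dop \<Rightarrow> 'n dop \<Rightarrow> bool" where
  "is_adjoint x0 x1 W Wt V N \<longleftrightarrow>
     (\<forall>Q. \<forall>x\<in>einterval x0 x1. invertible (W x) \<longrightarrow> meval (act Q N) x = adj_act W Wt V Q x)"

text \<open>
  The second clause is the form in which the standing assumption is used. Passing to it from the
  first one is an integration by parts whose boundary terms must vanish; that this is possible
  is part of what is assumed of the weights.
\<close>

definition good_enough ::
  "ereal \<Rightarrow> ereal \<Rightarrow> (real \<Rightarrow> complex^'n^'n) \<Rightarrow> bool" where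
  "good_enough x0 x1 W \<longleftrightarrow>
     (\<forall>(D :: ('n::finite) dop) A.
        (\<forall>P. set_integrable lborel (einterval x0 x1) (\<lambda>x. meval P x ** wact W D x) \<and>
             mint x0 x1 (\<lambda>x. meval P x ** meval A x ** W x)
               = mint x0 x1 (\<lambda>x. meval P x ** wact W D x))
        \<longrightarrow> (\<forall>x\<in>einterval x0 x1. meval A x ** W x = wact W D x)) \<and>
     (\<forall>(D :: 'n dop) Dt.
        (\<forall>P Q. pairing x0 x1 W (act P D) Q = pairing x0 x1 W P (act Q Dt))
        \<longrightarrow> is_adjoint x0 x1 W W D Dt)"

definition weight_sum :: "(real \<Rightarrow> complex^'n^'n) \<Rightarrow> (real \<Rightarrow> complex^'m^'m) \<Rightarrow>
    real \<Rightarrow> complex^('n + 'm)^('n + 'm)" where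
  "weight_sum W Wt x = (\<chi> a b. case (a, b) of
       (Inl i, Inl j) \<Rightarrow> W x $ i $ j
     | (Inr i, Inr j) \<Rightarrow> Wt x $ i $ j
     | _ \<Rightarrow> 0)"

end

theory Submission
  imports Defs
begin

text \<open>
  The adjoint of \<open>V\<close> for the two inner products exists as a left-linear map \<open>T\<close>: it sends \<open>Pt n\<close> to a
  constant multiple of \<open>P n\<close>, because the squared norms of \<open>P n\<close> and \<open>Pt n\<close> are invertible matrices.
  Multiplication by \<open>x\<close> is symmetric for both inner products, so the iterated commutators of \<open>T\<close>
  with \<open>x\<close> are, up to sign, the adjoints of those of \<open>V\<close>, and they vanish once their number exceeds
  the order of \<open>V\<close>. A left-linear map with this property is a differential operator with polynomial
  coefficients. The formula \<open>N = Wt V\<^sup>* W\<^sup>-\<^sup>1\<close> then comes from the standing assumption, applied to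
  the direct sum of the weights.
\<close>

section \<open>Matrices and matrix polynomials\<close>

lemma matrix_add_rdistrib:
  fixes A B :: "'a::semiring_1^'n^'m"
  shows "(A + B) ** C = A ** C + B ** C"
  by (simp add: vec_eq_iff matrix_matrix_mult_def distrib_right sum.distrib)

lemma matrix_mult_zero [simp]:
  fixes A :: "'a::semiring_1^'n^'m"
  shows "A ** 0 = 0" and "0 ** B = (0 :: 'a^'n^'m)"
  by (simp_all add: vec_eq_iff matrix_matrix_mult_def)

lemma matrix_mult_minus:
  fixes A :: "'a::ring_1^'n^'m"
  shows "A ** (- B) = - (A ** B)" and "(- A) ** B = - (A ** B)"
  by (simp_all add: vec_eq_iff matrix_matrix_mult_def sum_negf)

lemma matrix_mult_sum_right:
  fixes A :: "'a::semiring_1^'n^'m"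
  shows "A ** sum f S = (\<Sum>s\<in>S. A ** f s)"
  by (induction S rule: infinite_finite_induct) (simp_all add: matrix_add_ldistrib)

lemma matrix_mult_scaleR:
  fixes A :: "complex^'n^'m"
  shows "(c *\<^sub>R A) ** B = c *\<^sub>R (A ** B)" and "A ** (c *\<^sub>R B) = c *\<^sub>R (A ** B)"
  by (simp_all add: vec_eq_iff matrix_matrix_mult_def scaleR_sum_right)

text \<open>Linear maps in finite dimension are bounded; this lets constant matrix factors pass
  through integrals and derivatives.\<close>

lemma bounded_linear_matrix_mult_left: "bounded_linear (\<lambda>M :: complex^'n^'m. A ** M)"
  by (intro linear_conv_bounded_linear[THEN iffD1] linearI)
    (simp_all add: matrix_add_ldistrib matrix_mult_scaleR)

lemma bounded_linear_matrix_mult_right: "bounded_linear (\<lambda>M :: complex^'n^'m. M ** A)"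
  by (intro linear_conv_bounded_linear[THEN iffD1] linearI)
    (simp_all add: matrix_add_rdistrib matrix_mult_scaleR)

lemma invertible_iff_ker:
  fixes A :: "'a::field^'n^'n"
  shows "invertible A \<longleftrightarrow> (\<forall>v. A *v v = 0 \<longrightarrow> v = 0)"
  by (simp add: invertible_left_inverse matrix_left_invertible_ker)

lemma matrix_inv_mult:
  fixes A :: "'a::semiring_1^'n^'n"
  assumes "invertible A"
  shows "A ** matrix_inv A = mat 1" and "matrix_inv A ** A = mat 1"
  using assms unfolding invertible_def matrix_inv_def
  by (metis (mono_tags, lifting) someI_ex)+

lemma invertible_matrix_inv:
  fixes A :: "'a::semiring_1^'n^'n"
  shows "invertible A \<Longrightarrow> invertible (matrix_inv A)"
  using matrix_inv_mult invertible_def by blast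

lemma ctranspose_nth [simp]: "ctranspose A $ i $ j = cnj (A $ j $ i)"
  by (simp add: ctranspose_def transpose_def)

lemma ctranspose_mult: "ctranspose (A ** B) = ctranspose B ** ctranspose A"
  by (simp add: vec_eq_iff matrix_matrix_mult_def mult.commute)

lemma ctranspose_add: "ctranspose (A + B) = ctranspose A + ctranspose B"
  by (simp add: vec_eq_iff)

lemma ctranspose_scaleR: "ctranspose (c *\<^sub>R A) = c *\<^sub>R ctranspose A"
  by (simp add: vec_eq_iff)

lemma ctranspose_zero [simp]: "ctranspose 0 = 0"
  by (simp add: vec_eq_iff)

lemma ctranspose_one [simp]: "ctranspose (mat 1) = mat 1"
  by (auto simp: vec_eq_iff mat_def)

lemma ctranspose_ctranspose [simp]: "ctranspose (ctranspose A) = A"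
  by (simp add: vec_eq_iff)

lemma ctranspose_eq_0_iff [simp]: "ctranspose A = 0 \<longleftrightarrow> A = 0"
  by (metis ctranspose_ctranspose ctranspose_zero)

lemma invertible_ctranspose: "invertible A \<Longrightarrow> invertible (ctranspose A)"
  unfolding invertible_def by (metis ctranspose_mult ctranspose_one)

lemma mconst_mult: "mconst (A ** B) = mconst A ** mconst B"
proof -
  have [simp]: "[:\<Sum>k\<in>S. f k:] = (\<Sum>k\<in>S. [:f k:])" for f :: "'n \<Rightarrow> complex" and S
    by (simp add: poly_eq_iff coeff_sum coeff_pCons split: nat.split)
  show ?thesis
    by (simp add: mconst_def vec_eq_iff matrix_matrix_mult_def mult.commute)
qed

lemma meval_add: "meval (P + Q) x = meval P x + meval Q x"
  by (simp add: meval_def vec_eq_iff)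

lemma meval_zero [simp]: "meval 0 x = 0"
  by (simp add: meval_def vec_eq_iff)

lemma meval_mult: "meval (P ** Q) x = meval P x ** meval Q x"
  by (simp add: meval_def vec_eq_iff matrix_matrix_mult_def poly_sum)

lemma meval_mconst [simp]: "meval (mconst A) x = A"
  by (simp add: meval_def mconst_def vec_eq_iff)

lemma mconst_zero [simp]: "mconst 0 = 0"
  by (simp add: mconst_def vec_eq_iff)

section \<open>Multiplication by the variable, and coefficients of matrix polynomials\<close>

definition xmul :: "('n::finite) mpoly \<Rightarrow> 'n mpoly" where
  "xmul P = map_matrix (pCons 0) P"

lemma meval_xmul: "meval (xmul P) x = x *\<^sub>R meval P x"
  by (simp add: meval_def xmul_def vec_eq_iff scaleR_conv_of_real[where 'a = complex])

lemma xmul_zero [simp]: "xmul 0 = 0"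
  by (simp add: xmul_def vec_eq_iff)

lemma xmul_add: "xmul (P + Q) = xmul P + xmul Q"
  by (simp add: xmul_def vec_eq_iff)

lemma xmul_mult:
  shows "xmul P ** Q = xmul (P ** Q)" and "P ** xmul Q = xmul (P ** Q)"
proof -
  have [simp]: "pCons 0 (sum f S) = (\<Sum>k\<in>S. pCons 0 (f k))" for f :: "'n \<Rightarrow> complex poly" and S
    by (simp add: poly_eq_iff coeff_sum coeff_pCons split: nat.split)
  show "xmul P ** Q = xmul (P ** Q)" and "P ** xmul Q = xmul (P ** Q)"
    by (simp_all add: xmul_def vec_eq_iff matrix_matrix_mult_def)
qed

lemma xmul_sum: "xmul (sum f S) = (\<Sum>s\<in>S. xmul (f s))"
  by (induction S rule: infinite_finite_induct) (simp_all add: xmul_add)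

lemma mcoeff_mconst_mult: "mcoeff (mconst C ** P) k = C ** mcoeff P k"
  by (simp add: vec_eq_iff mcoeff_def mconst_def matrix_matrix_mult_def coeff_sum)

lemma mcoeff_diff: "mcoeff (P - Q) k = mcoeff P k - mcoeff Q k"
  by (simp add: vec_eq_iff mcoeff_def)

lemma mpoly_eq_0_iff: "P = 0 \<longleftrightarrow> (\<forall>k. mcoeff P k = 0)"
  by (auto simp: vec_eq_iff mcoeff_def poly_eq_iff)

lemma mpoly_degree_bound: "\<exists>d. \<forall>k>d. mcoeff P k = 0"
proof -
  let ?d = "Max (range (\<lambda>(i, j). degree (P $ i $ j)))"
  have "degree (P $ i $ j) \<le> ?d" for i j
    by (rule Max_ge) (auto intro: rev_image_eqI[of "(i, j)"])
  then show ?thesis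
    by (intro exI[of _ ?d]) (auto simp: vec_eq_iff mcoeff_def intro!: coeff_eq_0 intro: le_less_trans)
qed

lemma mpoly_decompose:
  obtains R where "P = mconst (mcoeff P 0) + xmul R" and "\<And>k. mcoeff R k = mcoeff P (Suc k)"
proof
  let ?R = "map_matrix (poly_shift 1) P"
  show "P = mconst (mcoeff P 0) + xmul ?R"
    by (simp add: vec_eq_iff mconst_def mcoeff_def xmul_def poly_eq_iff coeff_pCons coeff_poly_shift
        split: nat.split)
  show "\<And>k. mcoeff ?R k = mcoeff P (Suc k)"
    by (simp add: vec_eq_iff mcoeff_def coeff_poly_shift)
qed

text \<open>Horner's scheme: splitting off the constant term and dividing by \<open>x\<close> lowers
  the degree. The two cases match maps known through their values on constants and their commutator
  with \<open>xmul\<close>.\<close>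

lemma mpoly_induct [case_names const step]:
  assumes const: "\<And>C. Pr (mconst C)"
    and step: "\<And>C Q. Pr Q \<Longrightarrow> Pr (mconst C + xmul Q)"
  shows "Pr P"
proof -
  have "(\<forall>k>d. mcoeff P k = 0) \<Longrightarrow> Pr P" for d
  proof (induction d arbitrary: P)
    case 0
    obtain R where R: "P = mconst (mcoeff P 0) + xmul R" "\<And>k. mcoeff R k = mcoeff P (Suc k)"
      using mpoly_decompose by blast
    with 0 have "R = 0"
      by (simp add: mpoly_eq_0_iff)
    with R(1) have "P = mconst (mcoeff P 0)"
      by (simp add: xmul_def vec_eq_iff)
    then show ?case
      using const by metis
  next
    case (Suc d)
    obtain R where R: "P = mconst (mcoeff P 0) + xmul R" "\<And>k. mcoeff R k = mcoeff P (Suc k)"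
      using mpoly_decompose by blast
    with Suc have "Pr R"
      by simp
    with R(1) show ?case
      using step by metis
  qed
  then show ?thesis
    using mpoly_degree_bound by blast
qed


section \<open>Differential operators\<close>

lemma mderiv_add: "mderiv k (P + Q) = mderiv k P + mderiv k Q"
  by (simp add: mderiv_def vec_eq_iff higher_pderiv_add)

lemma mderiv_mconst_mult: "mderiv k (mconst C ** P) = mconst C ** mderiv k P"
  by (simp add: mderiv_def mconst_def vec_eq_iff matrix_matrix_mult_def higher_pderiv_sum
      higher_pderiv_smult)

text \<open>Leibniz rule with the factor \<open>x\<close>, whose second derivative vanishes, so only
  two terms survive.\<close>

lemma mderiv_Suc_xmul:
  "mderiv (Suc i) (xmul P) = xmul (mderiv (Suc i) P) + map_matrix (smult (of_nat (Suc i))) (mderiv i P)"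
proof -
  have "(pderiv ^^ Suc i) (pCons 0 p)
      = pCons 0 ((pderiv ^^ Suc i) p) + smult (of_nat (Suc i)) ((pderiv ^^ i) p)" for p :: "complex poly"
  proof (induction i)
    case (Suc i)
    show ?case
      by (subst funpow.simps(2), subst o_apply, subst Suc)
        (simp add: pderiv_pCons pderiv_add pderiv_smult smult_add_left numeral_poly)
  qed (simp add: pderiv_pCons)
  then show ?thesis
    by (simp add: mderiv_def xmul_def vec_eq_iff del: funpow.simps)
qed

lemma mderiv_const: "mderiv (Suc i) (mat 1) = 0"
proof -
  have "(pderiv ^^ Suc i) (if b then 1 else 0 :: complex poly) = 0" for b
    by (simp add: funpow_Suc_right pderiv_1 del: funpow.simps)
  then show ?thesis
    by (simp add: mderiv_def vec_eq_iff mat_def del: funpow.simps)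
qed

lemma act_add_left: "act (P + Q) D = act P D + act Q D"
  by (simp add: act_def mderiv_add matrix_add_rdistrib sum.distrib)

lemma act_mconst_left: "act (mconst C ** P) D = mconst C ** act P D"
  by (simp add: act_def mderiv_mconst_mult matrix_mult_sum_right matrix_mul_assoc)

lemma act_sum_left: "act (sum f S) D = (\<Sum>s\<in>S. act (f s) D)"
  by (induction S rule: infinite_finite_induct)
    (simp_all add: act_add_left, simp_all add: act_def mderiv_def vec_eq_iff matrix_matrix_mult_def)

lemma act_minus: "act P (- D) = - act P D"
  by (simp add: act_def matrix_mult_minus sum_negf)

text \<open>The operator \<open>V'\<close> is the commutator of \<open>V\<close> with multiplication by \<open>x\<close>, that is, the formal
  derivative of \<open>V\<close> with respect to \<open>\<partial>\<close>; hence the drop in order.\<close>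

lemma act_commutator:
  fixes V :: "('n::finite) dop"
  assumes "\<And>i. i > n \<Longrightarrow> coeff V i = 0"
  obtains V' where "\<And>i. i \<ge> n \<Longrightarrow> coeff V' i = 0"
    and "\<And>P. act (xmul P) V = xmul (act P V) + act P V'"
proof
  let ?F = "\<lambda>i. map_matrix (smult (of_nat (Suc i))) (coeff V (Suc i))"
  let ?V' = "\<Sum>i<n. monom (?F i) i"
  show "coeff ?V' i = 0" if "i \<ge> n" for i
    using that by (auto simp: coeff_sum intro!: sum.neutral)
  fix P
  have deg: "degree V \<le> n"
    using assms by (simp add: degree_le)
  \<comment> \<open>The order-zero term commutes with multiplication by \<open>x\<close>, so it is
    split off before \<open>mderiv_Suc_xmul\<close> is applied.\<close>
  have "act (xmul P) V = xmul P ** coeff V 0 + (\<Sum>i<n. mderiv (Suc i) (xmul P) ** coeff V (Suc i))"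
    using act_upto[OF deg] by (simp add: sum.atMost_shift)
  also have "(\<Sum>i<n. mderiv (Suc i) (xmul P) ** coeff V (Suc i))
      = xmul (\<Sum>i<n. mderiv (Suc i) P ** coeff V (Suc i)) + act P ?V'"
    by (simp add: mderiv_Suc_xmul matrix_add_rdistrib sum.distrib xmul_mult xmul_sum act_sum act_monom
        smult_matrix_mult)
  also have "xmul P ** coeff V 0 + (xmul (\<Sum>i<n. mderiv (Suc i) P ** coeff V (Suc i)) + act P ?V')
      = xmul (act P V) + act P ?V'"
    using act_upto[OF deg, of P] by (simp add: sum.atMost_shift xmul_mult xmul_add)
  finally show "act (xmul P) V = xmul (act P V) + act P ?V'" .
qed

text \<open>Converse of \<open>act_commutator\<close>: \<open>D\<close> is integrated formally with
  respect to the derivation symbol, the coefficient of order \<open>i\<close> moving to order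
  \<open>Suc i\<close> with the factor \<open>1 / of_nat (Suc i)\<close>. The constant of
  integration is the order-zero term \<open>F\<close>, read off at \<open>mat 1\<close>, which the
  higher orders annihilate.\<close>

lemma act_antiderivative:
  fixes D :: "('n::finite) dop"
  obtains N where "act (mat 1) N = F" and "\<And>P. act (xmul P) N = xmul (act P N) + act P D"
proof
  let ?G = "\<lambda>i. map_matrix (smult (1 / of_nat (Suc i))) (coeff D i)"
  let ?N = "monom F 0 + (\<Sum>i\<le>degree D. monom (?G i) (Suc i))"
  have act_N: "act P ?N = P ** F + (\<Sum>i\<le>degree D. mderiv (Suc i) P ** ?G i)" for P
    by (simp add: act_add act_sum act_monom)
  show "act (mat 1) ?N = F"
    unfolding act_N by (simp add: mderiv_const)
  fix P
  have G: "map_matrix (smult (of_nat (Suc i))) (?G i) = coeff D i" for i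
    by (simp add: vec_eq_iff del: of_nat_Suc)
  have "map_matrix (smult (of_nat (Suc i))) (mderiv i P) ** ?G i = mderiv i P ** coeff D i" for i
    by (metis G smult_matrix_mult)
  then show "act (xmul P) ?N = xmul (act P ?N) + act P D"
    unfolding act_N
    by (simp add: mderiv_Suc_xmul matrix_add_rdistrib sum.distrib xmul_mult xmul_add xmul_sum act_def
        del: of_nat_Suc)
qed

section \<open>The matrix-valued inner product\<close>

text \<open>The set where \<open>f\<close> and \<open>g\<close> differ is open and null, hence
  empty. This removes the exceptional null set from identities obtained through positive
  definiteness.\<close>

lemma AE_eq_on_open:
  fixes f g :: "real \<Rightarrow> 'a::real_normed_vector"
  assumes "open S" and "continuous_on S f" "continuous_on S g"
    and ae: "AE x in lborel. x \<in> S \<longrightarrow> f x = g x" and "x \<in> S"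
  shows "f x = g x"
proof (rule ccontr)
  assume ne: "f x \<noteq> g x"
  let ?U = "(\<lambda>y. f y - g y) -` (- {0}) \<inter> S"
  have U: "open ?U"
    using assms continuous_on_open_vimage[of S "\<lambda>y. f y - g y"]
    by (auto intro!: continuous_intros)
  have "?U \<in> null_sets lborel"
    using ae U by (subst AE_iff_null_sets) (auto elim: eventually_mono)
  then have "negligible ?U"
    by (simp add: negligible_iff_null_sets null_sets_completionI)
  moreover have "?U \<noteq> {}"
    using ne \<open>x \<in> S\<close> by auto
  ultimately show False
    using open_not_negligible[OF U] by blast
qed

lemma einterval_nonempty:
  assumes "x0 < x1"
  shows "einterval x0 x1 \<noteq> {}"
  using ereal_dense3[OF assms] by (auto simp: einterval_def dest: less_trans)

lemma infinite_einterval: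
  assumes "x0 < x1"
  shows "infinite (einterval x0 x1)"
  using open_not_negligible[OF open_einterval einterval_nonempty[OF assms]] negligible_finite by blast

section \<open>Integrals and bounded linear maps\<close>

lemma set_integrable_bounded_linear:
  fixes f :: "real \<Rightarrow> 'a::{banach, second_countable_topology}"
    and L :: "'a \<Rightarrow> 'b::{banach, second_countable_topology}"
  assumes "bounded_linear L" "set_integrable M S f"
  shows "set_integrable M S (\<lambda>x. L (f x))"
  using integrable_bounded_linear[OF assms(1) assms(2)[unfolded set_integrable_def]]
  by (simp add: set_integrable_def bounded_linear.linear[OF assms(1)] linear_scale)

lemma set_integral_bounded_linear:
  fixes f :: "real \<Rightarrow> 'a::{banach, second_countable_topology}"
    and L :: "'a \<Rightarrow> 'b::{banach, second_countable_topology}"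
  assumes "bounded_linear L" "set_integrable M S f"
  shows "set_lebesgue_integral M S (\<lambda>x. L (f x)) = L (set_lebesgue_integral M S f)"
  using integral_bounded_linear[OF assms(1) assms(2)[unfolded set_integrable_def]]
  by (simp add: set_lebesgue_integral_def bounded_linear.linear[OF assms(1)] linear_scale)

lemma scaleR_mult_vector: "(r *\<^sub>R M) *v v = r *\<^sub>R (M *v (v :: complex^'n))"
  by (simp add: vec_eq_iff matrix_vector_mult_def scaleR_sum_right)

section \<open>Hermitian forms and positive definite matrices\<close>

definition cdot :: "complex^'n \<Rightarrow> complex^'n \<Rightarrow> complex" where
  "cdot u v = (\<Sum>i\<in>UNIV. cnj (u $ i) * v $ i)"

lemma cdot_ctranspose: "cdot u (A *v v) = cdot (ctranspose A *v u) v"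
  by (simp add: cdot_def matrix_vector_mult_def sum_distrib_left sum_distrib_right mult_ac)
    (subst sum.swap, simp)

lemma pos_def_cdot:
  "pos_def M \<longleftrightarrow> ctranspose M = M \<and> (\<forall>v. v \<noteq> 0 \<longrightarrow> Re (cdot v (M *v v)) > 0)"
  by (simp add: pos_def_def cdot_def matrix_vector_mult_def sum_distrib_left mult.assoc)

lemma pos_def_invertible: "pos_def M \<Longrightarrow> invertible M"
  unfolding pos_def_cdot invertible_iff_ker by (force simp: cdot_def)

definition finite_moments :: "ereal \<Rightarrow> ereal \<Rightarrow> (real \<Rightarrow> complex^'n^'n) \<Rightarrow> bool" where
  "finite_moments x0 x1 f \<longleftrightarrow>
     (\<forall>k::nat. set_integrable lborel (einterval x0 x1) (\<lambda>x. x ^ k *\<^sub>R f x))"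

lemma finite_moments_meval:
  assumes f: "finite_moments x0 x1 f"
  shows "finite_moments x0 x1 (\<lambda>x. meval P x ** f x)"
proof (induction P rule: mpoly_induct)
  case (const C)
  then show ?case
    using f unfolding finite_moments_def meval_mconst matrix_mult_scaleR(2)[symmetric]
    by (intro allI set_integrable_bounded_linear[OF bounded_linear_matrix_mult_left]) simp
next
  case (step C Q)
  have "set_integrable lborel (einterval x0 x1)
      (\<lambda>x. C ** (x ^ k *\<^sub>R f x) + x ^ Suc k *\<^sub>R (meval Q x ** f x))" for k
    using f step unfolding finite_moments_def
    by (intro set_integral_add set_integrable_bounded_linear[OF bounded_linear_matrix_mult_left]) blast+
  then show ?case
    by (simp add: finite_moments_def meval_add meval_xmul matrix_add_rdistrib scaleR_add_right
        matrix_mult_scaleR mult.commute)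
qed

lemma bounded_linear_ctranspose: "bounded_linear (ctranspose :: complex^'n^'m \<Rightarrow> _)"
  by (intro linear_conv_bounded_linear[THEN iffD1] linearI) (simp_all add: ctranspose_add ctranspose_scaleR)

text \<open>Exchanges left and right factors, so that \<open>finite_moments_meval\<close> also
  covers the polynomial to the right of the weight.\<close>

lemma finite_moments_ctranspose:
  "finite_moments x0 x1 f \<Longrightarrow> finite_moments x0 x1 (\<lambda>x. ctranspose (f x))"
  using set_integrable_bounded_linear[OF bounded_linear_ctranspose]
  by (auto simp: finite_moments_def ctranspose_scaleR[symmetric])

locale matrix_weight =
  fixes x0 x1 :: ereal and W :: "real \<Rightarrow> complex^'n^('n::finite)"
  assumes weight: "weight x0 x1 W"
begin

abbreviation ip :: "'n mpoly \<Rightarrow> 'n mpoly \<Rightarrow> complex^'n^'n" where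
  "ip \<equiv> pairing x0 x1 W"

lemma integrable:
  "set_integrable lborel (einterval x0 x1) (\<lambda>x. meval P x ** W x ** ctranspose (meval Q x))"
proof -
  have "finite_moments x0 x1 W"
    using weight by (simp add: weight_def finite_moments_def)
  then have "finite_moments x0 x1
      (\<lambda>x. ctranspose (meval Q x ** ctranspose (meval P x ** W x)))"
    by (intro finite_moments_ctranspose finite_moments_meval)
  then have "set_integrable lborel (einterval x0 x1)
      (\<lambda>x. x ^ 0 *\<^sub>R ctranspose (meval Q x ** ctranspose (meval P x ** W x)))"
    unfolding finite_moments_def by blast
  then show ?thesis
    by (simp add: ctranspose_mult)
qed

lemma ip_add_left: "ip (P + P') Q = ip P Q + ip P' Q"
  using set_integral_add(2)[OF integrable integrable]
  by (simp add: pairing_def mint_def meval_add matrix_add_rdistrib)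

lemma ip_add_right: "ip P (Q + Q') = ip P Q + ip P Q'"
  using set_integral_add(2)[OF integrable integrable]
  by (simp add: pairing_def mint_def meval_add matrix_add_ldistrib ctranspose_add)

lemma ip_zero [simp]: "ip 0 Q = 0" "ip P 0 = 0"
  by (simp_all add: pairing_def mint_def)

lemma ip_sum_left: "ip (sum f S) Q = (\<Sum>s\<in>S. ip (f s) Q)"
  by (induction S rule: infinite_finite_induct) (simp_all add: ip_add_left)

lemma ip_sum_right: "ip P (sum f S) = (\<Sum>s\<in>S. ip P (f s))"
  by (induction S rule: infinite_finite_induct) (simp_all add: ip_add_right)

lemma ip_diff_right: "ip P (Q - Q') = ip P Q - ip P Q'"
  using ip_add_right[of P "Q - Q'" Q'] by simp

lemma ip_mconst_left: "ip (mconst C ** P) Q = C ** ip P Q"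
  using set_integral_bounded_linear[OF bounded_linear_matrix_mult_left integrable]
  by (simp add: pairing_def mint_def meval_mult matrix_mul_assoc)

lemma ip_mconst_right: "ip P (mconst C ** Q) = ip P Q ** ctranspose C"
  using set_integral_bounded_linear[OF bounded_linear_matrix_mult_right integrable]
  by (simp add: pairing_def mint_def meval_mult matrix_mul_assoc ctranspose_mult)

text \<open>The variable is real, so it passes through the conjugate transpose. This symmetry
  transfers commutators with \<open>x\<close> from an operator to its adjoint.\<close>

lemma ip_xmul: "ip (xmul P) Q = ip P (xmul Q)"
  by (simp add: pairing_def meval_xmul ctranspose_scaleR matrix_mult_scaleR)

text \<open>For \<open>u\<close> in the kernel, the form of \<open>ip P P\<close> at
  \<open>u\<close> is the integral of the form of \<open>W x\<close> at \<open>?v x\<close>. The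
  integrand is nonnegative with integral zero, so \<open>?v\<close> vanishes almost everywhere. By
  continuity the polynomial entries of the row u^* P vanish on an infinite set, hence identically,
  and comparing coefficients of degree \<open>n\<close> gives \<open>u = 0\<close>.\<close>

lemma invertible_norm:
  assumes inv: "invertible (mcoeff P n)"
  shows "invertible (ip P P)"
  unfolding invertible_iff_ker
proof (intro allI impI)
  fix u assume u: "ip P P *v u = 0"
  let ?I = "einterval x0 x1"
  let ?v = "\<lambda>x. ctranspose (meval P x) *v u"
  let ?F = "\<lambda>x. meval P x ** W x ** ctranspose (meval P x)"
  let ?L = "\<lambda>M. Re (cdot u (M *v u))"
  have lin: "bounded_linear ?L"
    by (intro linear_conv_bounded_linear[THEN iffD1] linearI)
      (simp_all add: cdot_def matrix_vector_mult_add_rdistrib scaleR_mult_vector distrib_left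
        sum.distrib sum_distrib_left algebra_simps)
  have L: "?L (?F x) = Re (cdot (?v x) (W x *v ?v x))" for x
    by (simp add: matrix_vector_mul_assoc[symmetric] cdot_ctranspose[of u])
  have pos: "AE x in lborel. x \<in> ?I \<longrightarrow> pos_def (W x)"
    using weight by (simp add: weight_def)
  have int: "integrable lborel (\<lambda>x. indicator ?I x *\<^sub>R ?L (?F x))"
    using set_integrable_bounded_linear[OF lin integrable] by (simp add: set_integrable_def)
  have nonneg: "AE x in lborel. 0 \<le> indicator ?I x *\<^sub>R ?L (?F x)"
    using pos
  proof eventually_elim
    case (elim x)
    then show ?case
      unfolding L pos_def_cdot
      by (cases "?v x = 0") (auto simp: indicator_def cdot_def intro: less_imp_le)
  qed
  have "(LINT x|lborel. indicator ?I x *\<^sub>R ?L (?F x)) = ?L (ip P P)"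
    using set_integral_bounded_linear[OF lin integrable]
    by (simp add: set_lebesgue_integral_def pairing_def mint_def)
  also have "\<dots> = 0"
    using u by (simp add: cdot_def)
  finally have "AE x in lborel. indicator ?I x *\<^sub>R ?L (?F x) = 0"
    using integral_nonneg_eq_0_iff_AE[OF int nonneg] by simp
  then have ae: "AE x in lborel. x \<in> ?I \<longrightarrow> ?v x = 0"
    using pos
  proof eventually_elim
    case (elim x)
    then show ?case
      unfolding L pos_def_cdot by (force simp: indicator_def)
  qed
  \<comment> \<open>Conjugating entry \<open>i\<close> of \<open>?v x\<close> gives a polynomial in
    \<open>x\<close>, namely entry \<open>i\<close> of u^* P.\<close>
  let ?p = "\<lambda>i. \<Sum>j\<in>UNIV. smult (cnj (u $ j)) (P $ j $ i)"
  have p: "cnj (?v x $ i) = poly (?p i) (of_real x)" for x i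
    by (simp add: matrix_vector_mult_def meval_def poly_sum mult.commute)
  have "?p i = 0" for i
  proof -
    have "poly (?p i) (of_real x) = 0" if "x \<in> ?I" for x
    proof (rule AE_eq_on_open[OF open_einterval _ _ _ that])
      show "continuous_on ?I (\<lambda>x. poly (?p i) (of_real x))"
        by (intro continuous_intros)
      show "AE x in lborel. x \<in> ?I \<longrightarrow> poly (?p i) (of_real x) = 0"
        using ae by eventually_elim (simp add: p[symmetric])
    qed simp
    then have "of_real ` ?I \<subseteq> {z. poly (?p i) z = 0}"
      by auto
    moreover have "infinite (of_real ` ?I :: complex set)"
      using infinite_einterval weight by (simp add: weight_def finite_image_iff inj_on_def)
    ultimately show ?thesis
      using poly_roots_finite finite_subset by blast
  qed
  then have "cnj (coeff (?p i) n) = 0" for i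
    by simp
  then have "ctranspose (mcoeff P n) *v u = 0"
    by (simp add: vec_eq_iff matrix_vector_mult_def mcoeff_def coeff_sum mult.commute)
  then show "u = 0"
    using invertible_ctranspose[OF inv] by (simp add: invertible_iff_ker)
qed

end

section \<open>Orthogonal sequences as bases over left constants\<close>

locale orthogonal_polynomials = matrix_weight x0 x1 W
  for x0 x1 :: ereal and W :: "real \<Rightarrow> complex^'n^('n::finite)" +
  fixes P :: "nat \<Rightarrow> 'n mpoly"
  assumes orth: "orthogonal_seq x0 x1 W P"
begin

lemma orth_simps:
  shows mcoeff_above: "k > n \<Longrightarrow> mcoeff (P n) k = 0"
    and invertible_lead: "invertible (mcoeff (P n) n)"
    and ip_orth: "n \<noteq> m \<Longrightarrow> ip (P n) (P m) = 0"
  using orth unfolding orthogonal_seq_def by blast+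

lemma invertible_sqnorm: "invertible (ip (P n) (P n))"
  using invertible_norm invertible_lead .

text \<open>Leading terms are removed one degree at a time, which the invertible leading
  coefficients allow with constants on the left.\<close>

lemma expansion:
  obtains d C where "Q = (\<Sum>n<d. mconst (C n) ** P n)"
proof -
  have "(\<forall>k\<ge>d. mcoeff Q k = 0) \<Longrightarrow> \<exists>C. Q = (\<Sum>n<d. mconst (C n) ** P n)" for d
  proof (induction d arbitrary: Q)
    case 0
    then show ?case
      by (simp add: mpoly_eq_0_iff)
  next
    case (Suc d)
    let ?c = "mcoeff Q d ** matrix_inv (mcoeff (P d) d)"
    let ?R = "Q - mconst ?c ** P d"
    have "?c ** mcoeff (P d) d = mcoeff Q d"
      by (simp add: matrix_mul_assoc[symmetric] matrix_inv_mult invertible_lead)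
    then have "mcoeff ?R k = 0" if "k \<ge> d" for k
      using that Suc.prems mcoeff_above[of d k]
      by (cases "k = d") (auto simp: mcoeff_diff mcoeff_mconst_mult)
    then obtain C where C: "?R = (\<Sum>n<d. mconst (C n) ** P n)"
      using Suc.IH by blast
    have "(\<Sum>n<d. mconst ((C(d := ?c)) n) ** P n) = (\<Sum>n<d. mconst (C n) ** P n)"
      by (intro sum.cong) auto
    then have "Q = (\<Sum>n<Suc d. mconst ((C(d := ?c)) n) ** P n)"
      by (simp add: C[symmetric])
    then show ?case
      by blast
  qed
  moreover obtain d where "\<forall>k>d. mcoeff Q k = 0"
    using mpoly_degree_bound by blast
  ultimately show ?thesis
    using that by (metis Suc_le_eq)
qed

lemma ip_sum_orth:
  assumes "m < d"
  shows "ip (P m) (\<Sum>n<d. mconst (C n) ** P n) = ip (P m) (P m) ** ctranspose (C m)"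
proof -
  have "ip (P m) (\<Sum>n<d. mconst (C n) ** P n)
      = (\<Sum>n<d. if n = m then ip (P m) (P m) ** ctranspose (C m) else 0)"
    unfolding ip_sum_right ip_mconst_right by (intro sum.cong refl) (auto simp: ip_orth)
  then show ?thesis
    using assms by simp
qed

text \<open>The inner products with \<open>P m\<close> determine the expansion coefficients of
  \<open>Q\<close>, because the squared norms are invertible.\<close>

lemma nondegenerate:
  assumes "\<And>m. ip (P m) Q = 0"
  shows "Q = 0"
proof -
  obtain d C where Q: "Q = (\<Sum>n<d. mconst (C n) ** P n)"
    using expansion .
  have "C m = 0" if "m < d" for m
  proof -
    have "ip (P m) (P m) ** ctranspose (C m) = 0"
      using assms[of m] ip_sum_orth[OF that] Q by simp
    then have "matrix_inv (ip (P m) (P m)) ** (ip (P m) (P m) ** ctranspose (C m)) = 0"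
      by simp
    then show ?thesis
      by (simp add: matrix_mul_assoc matrix_inv_mult invertible_sqnorm)
  qed
  then show ?thesis
    by (simp add: Q)
qed

end

section \<open>Adjoints of differential operators between two weights\<close>

locale two_weights = W: matrix_weight x0 x1 W + Wt: matrix_weight x0 x1 Wt
  for x0 x1 :: ereal and W Wt :: "real \<Rightarrow> complex^'n^('n::finite)"
begin

text \<open>Induction on the order of \<open>V\<close>: if \<open>N'\<close> is the adjoint of the commutator \<open>V'\<close>, the adjoint of
  \<open>V\<close> has commutator \<open>-N'\<close> with \<open>x\<close>, which together with its value at the constant polynomial
  determines it.\<close>

lemma adjoint_is_differential_operator:
  fixes V :: "'n dop"
  assumes "\<And>Q. \<exists>R. \<forall>P. Wt.ip (act P V) Q = W.ip P R"
  obtains N where "\<And>P Q. Wt.ip (act P V) Q = W.ip P (act Q N)"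
proof -
  \<comment> \<open>The bound \<open>s\<close> on the order is exclusive, so \<open>s = 0\<close>
    means \<open>V = 0\<close>. The existence of a representing \<open>R\<close> is carried along,
    since it must be established for the commutator too.\<close>
  have "\<exists>N. \<forall>P Q. Wt.ip (act P V) Q = W.ip P (act Q N)"
    if "\<forall>i\<ge>s. coeff V i = 0" "\<And>Q. \<exists>R. \<forall>P. Wt.ip (act P V) Q = W.ip P R" for s V
    using that
  proof (induction s arbitrary: V)
    case 0
    then have "V = 0"
      by (simp add: poly_eq_iff)
    then show ?case
      by (intro exI[of _ 0]) simp
  next
    case (Suc s)
    then have "coeff V i = 0" if "i > s" for i
      using that by simp
    then obtain V' where V': "\<And>i. i \<ge> s \<Longrightarrow> coeff V' i = 0"
        "\<And>P. act (xmul P) V = xmul (act P V) + act P V'"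
      using act_commutator[of s V] by blast
    have comm: "Wt.ip (act P V) (xmul Q) = Wt.ip (act (xmul P) V) Q - Wt.ip (act P V') Q" for P Q
      by (simp add: V'(2) Wt.ip_add_left Wt.ip_xmul)
    \<comment> \<open>The representing polynomial is \<open>xmul R - R'\<close>, where
      \<open>R\<close> represents the functional at \<open>Q\<close> and \<open>R'\<close> the one
      at \<open>xmul Q\<close>.\<close>
    have "\<exists>R. \<forall>P. Wt.ip (act P V') Q = W.ip P R" for Q
    proof -
      obtain R R' where "\<And>P. Wt.ip (act P V) Q = W.ip P R" "\<And>P. Wt.ip (act P V) (xmul Q) = W.ip P R'"
        using Suc.prems(2) by metis
      then have "Wt.ip (act P V') Q = W.ip P (xmul R - R')" for P
        using comm[of P Q] by (simp add: W.ip_add_right W.ip_diff_right W.ip_xmul algebra_simps)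
      then show ?thesis
        by blast
    qed
    then obtain N' where N': "\<And>P Q. Wt.ip (act P V') Q = W.ip P (act Q N')"
      using Suc.IH V'(1) by blast
    obtain F where F: "\<And>P. Wt.ip (act P V) (mat 1) = W.ip P F"
      using Suc.prems(2) by blast
    obtain N where N: "act (mat 1) N = F" "\<And>P. act (xmul P) N = xmul (act P N) + act P (- N')"
      using act_antiderivative[of F "- N'"] by blast
    \<comment> \<open>A left constant in the second argument leaves both products as the same right
      factor, so the value at \<open>mat 1\<close> settles all constants.\<close>
    have on_const: "Wt.ip (act P V) (mconst C) = W.ip P (act (mconst C) N)" for P C
      using Wt.ip_mconst_right[of "act P V" C "mat 1"] W.ip_mconst_right[of P C F]
        act_mconst_left[of C "mat 1" N] F N(1) by simp
    have "\<forall>P. Wt.ip (act P V) Q = W.ip P (act Q N)" for Q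
    proof (induction Q rule: mpoly_induct)
      case (const C)
      then show ?case
        by (simp add: on_const)
    next
      case (step C Q)
      have "Wt.ip (act P V) (xmul Q) = W.ip P (act (xmul Q) N)" for P
        using step by (simp add: comm N(2) N' act_minus W.ip_add_right W.ip_diff_right W.ip_xmul)
      then show ?case
        by (simp add: act_add_left Wt.ip_add_right W.ip_add_right on_const)
    qed
    then show ?case
      by blast
  qed
  moreover have "\<forall>i\<ge>Suc (degree V). coeff V i = 0"
    by (simp add: coeff_eq_0)
  ultimately show ?thesis
    using assms that by blast
qed

end

section \<open>The adjoint of the intertwining operator on the orthogonal sequences\<close>

locale darboux = two_weights x0 x1 W Wt
    + P: orthogonal_polynomials x0 x1 W P + Pt: orthogonal_polynomials x0 x1 Wt Pt
  for x0 x1 :: ereal and W Wt :: "real \<Rightarrow> complex^'n^('n::finite)" and P Pt +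
  fixes V :: "'n dop" and A :: "nat \<Rightarrow> complex^'n^'n"
  assumes act_V: "act (P n) V = mconst (A n) ** Pt n"
begin

text \<open>The solution of \<open>A n ** Wt.ip (Pt n) (Pt n) = W.ip (P n) (P n) ** ctranspose (At
  n)\<close>, which is the adjoint relation tested on \<open>P n\<close> and
  \<open>Pt n\<close>.\<close>

definition At :: "nat \<Rightarrow> complex^'n^'n" where
  "At n = ctranspose (matrix_inv (W.ip (P n) (P n)) ** A n ** Wt.ip (Pt n) (Pt n))"

lemma invertible_At: "invertible (A n) \<Longrightarrow> invertible (At n)"
  unfolding At_def
  by (intro invertible_ctranspose invertible_mult invertible_matrix_inv P.invertible_sqnorm
      Pt.invertible_sqnorm)

text \<open>Off the diagonal both sides vanish by orthogonality; on it the equation is the one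
  solved by \<open>At\<close>.\<close>

lemma adjoint_on_sequence: "Wt.ip (act (P m) V) (Pt n) = W.ip (P m) (mconst (At n) ** P n)"
proof (cases "m = n")
  case True
  have "W.ip (P n) (P n) ** (matrix_inv (W.ip (P n) (P n)) ** A n ** Wt.ip (Pt n) (Pt n))
      = A n ** Wt.ip (Pt n) (Pt n)"
    by (simp add: matrix_mul_assoc matrix_inv_mult P.invertible_sqnorm)
  with True show ?thesis
    by (simp add: act_V Wt.ip_mconst_left W.ip_mconst_right At_def)
next
  case False
  then show ?thesis
    by (simp add: act_V Wt.ip_mconst_left W.ip_mconst_right P.ip_orth Pt.ip_orth)
qed

lemma adjoint_on_Pt: "Wt.ip (act Q V) (Pt n) = W.ip Q (mconst (At n) ** P n)"
proof -
  obtain d C where "Q = (\<Sum>n<d. mconst (C n) ** P n)"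
    using P.expansion .
  then show ?thesis
    by (simp add: act_sum_left act_mconst_left W.ip_sum_left Wt.ip_sum_left W.ip_mconst_left
        Wt.ip_mconst_left adjoint_on_sequence)
qed

text \<open>\<open>R\<close> arises from the expansion of \<open>Q\<close> by replacing each
  \<open>Pt n\<close> with \<open>mconst (At n) ** P n\<close>.\<close>

lemma adjoint_exists: "\<exists>R. \<forall>P. Wt.ip (act P V) Q = W.ip P R"
proof -
  obtain d C where "Q = (\<Sum>n<d. mconst (C n) ** Pt n)"
    using Pt.expansion .
  then have "Wt.ip (act P' V) Q = W.ip P' (\<Sum>n<d. mconst (C n) ** (mconst (At n) ** P n))" for P'
    by (simp add: W.ip_sum_right Wt.ip_sum_right W.ip_mconst_right[of _ _ "_ ** _"]
        Wt.ip_mconst_right adjoint_on_Pt)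
  then show ?thesis
    by blast
qed

lemma adjoint_operator:
  obtains N where "\<And>P Q. Wt.ip (act P V) Q = W.ip P (act Q N)"
    and "\<And>n. act (Pt n) N = mconst (At n) ** P n"
proof -
  obtain N where N: "\<And>P Q. Wt.ip (act P V) Q = W.ip P (act Q N)"
    using adjoint_is_differential_operator adjoint_exists by blast
  \<comment> \<open>Both terms represent the same functional through \<open>W.ip\<close>, so
    nondegeneracy identifies them.\<close>
  have "act (Pt n) N - mconst (At n) ** P n = 0" for n
    by (rule P.nondegenerate) (simp add: W.ip_diff_right N[symmetric] adjoint_on_Pt)
  then show ?thesis
    using N that by simp
qed

end

section \<open>Smooth functions\<close>

lemma vderiv_Suc: "vderiv (Suc k) f x = vector_derivative (vderiv k f) (at x)"
  by (simp add: vderiv_def)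

lemma vderiv_0 [simp]: "vderiv 0 f = f"
  by (simp add: vderiv_def)

lemma smooth_has_vderiv:
  assumes "smooth_on_open S f" "x \<in> S"
  shows "(vderiv k f has_vector_derivative vderiv (Suc k) f x) (at x)"
  using assms unfolding smooth_on_open_def vderiv_Suc vector_derivative_works[symmetric] by blast

text \<open>\<open>vderiv\<close> lives on the whole real line, but derivatives are local: on an
  open set any chain of successive derivatives starting from \<open>f\<close> computes it.
  Smoothness and formulas for derivatives are both obtained by exhibiting such a chain.\<close>

lemma vderiv_unique:
  fixes g :: "nat \<Rightarrow> real \<Rightarrow> 'a::real_normed_vector"
  assumes S: "open S"
    and g: "\<And>k x. x \<in> S \<Longrightarrow> (g k has_vector_derivative g (Suc k) x) (at x)"
    and f: "\<And>x. x \<in> S \<Longrightarrow> f x = g 0 x"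
  shows "smooth_on_open S f" and "\<And>k x. x \<in> S \<Longrightarrow> vderiv k f x = g k x"
proof -
  have eq: "vderiv k f x = g k x" if "x \<in> S" for k x
    using that
  proof (induction k arbitrary: x)
    case (Suc k)
    have "(vderiv k f has_vector_derivative g (Suc k) x) (at x)"
      by (rule has_vector_derivative_transform_within_open[OF g S]) (use Suc in auto)
    then show ?case
      by (simp add: vderiv_Suc vector_derivative_at)
  qed (simp add: f)
  then show "\<And>k x. x \<in> S \<Longrightarrow> vderiv k f x = g k x" .
  have "(vderiv k f has_vector_derivative g (Suc k) x) (at x)" if "x \<in> S" for k x
    by (rule has_vector_derivative_transform_within_open[OF g S]) (use that eq in auto)
  then show "smooth_on_open S f"
    unfolding smooth_on_open_def using S differentiableI_vector by blast
qed

lemma smooth_bounded_linear: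
  assumes L: "bounded_linear L" and f: "smooth_on_open S f"
  shows "smooth_on_open S (\<lambda>x. L (f x))"
    and "\<And>k x. x \<in> S \<Longrightarrow> vderiv k (\<lambda>x. L (f x)) x = L (vderiv k f x)"
proof -
  have "open S"
    using f by (simp add: smooth_on_open_def)
  moreover have "((\<lambda>x. L (vderiv k f x)) has_vector_derivative L (vderiv (Suc k) f x)) (at x)"
    if "x \<in> S" for k x
    using bounded_linear.has_vector_derivative[OF L smooth_has_vderiv[OF f that]] .
  ultimately show "smooth_on_open S (\<lambda>x. L (f x))"
    and "\<And>k x. x \<in> S \<Longrightarrow> vderiv k (\<lambda>x. L (f x)) x = L (vderiv k f x)"
    using vderiv_unique[of S "\<lambda>k x. L (vderiv k f x)" "\<lambda>x. L (f x)"] by simp_all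
qed

lemma smooth_add:
  assumes "smooth_on_open S f" "smooth_on_open S g"
  shows "smooth_on_open S (\<lambda>x. f x + g x)"
proof (rule vderiv_unique)
  show "open S"
    using assms by (simp add: smooth_on_open_def)
  show "((\<lambda>x. vderiv k f x + vderiv k g x) has_vector_derivative
      vderiv (Suc k) f x + vderiv (Suc k) g x) (at x)" if "x \<in> S" for k x
    using assms smooth_has_vderiv that by (intro has_vector_derivative_add) blast+
qed simp

lemma smooth_mult_ident:
  assumes f: "smooth_on_open S f"
  shows "smooth_on_open S (\<lambda>x. x *\<^sub>R f x)"
proof (rule vderiv_unique)
  show "open S"
    using f by (simp add: smooth_on_open_def)
  \<comment> \<open>Leibniz formula for the factor \<open>x\<close>. At \<open>k = 0\<close> the
    truncated \<open>k - 1\<close> is harmless because of the factor \<open>real k\<close>.\<close>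
  let ?g = "\<lambda>k x. x *\<^sub>R vderiv k f x + real k *\<^sub>R vderiv (k - 1) f x"
  fix k x assume x: "x \<in> S"
  note d = smooth_has_vderiv[OF f x]
  have 1: "((\<lambda>x. x *\<^sub>R vderiv k f x) has_vector_derivative
      x *\<^sub>R vderiv (Suc k) f x + vderiv k f x) (at x)"
    using has_vector_derivative_scaleR[OF DERIV_ident d[of k]] by simp
  have 2: "((\<lambda>x. real k *\<^sub>R vderiv (k - 1) f x) has_vector_derivative real k *\<^sub>R vderiv k f x) (at x)"
  proof (cases k)
    case (Suc j)
    then show ?thesis
      using has_vector_derivative_scaleR[OF DERIV_const d[of j], of "real k"] by simp
  qed simp
  show "(?g k has_vector_derivative ?g (Suc k) x) (at x)"
    using has_vector_derivative_add[OF 1 2] by (simp add: scaleR_add_left algebra_simps)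
qed simp

lemma smooth_meval:
  assumes f: "smooth_on_open S f"
  shows "smooth_on_open S (\<lambda>x. meval P x ** f x)"
proof (induction P rule: mpoly_induct)
  case (const C)
  then show ?case
    using smooth_bounded_linear(1)[OF bounded_linear_matrix_mult_left f] by simp
next
  case (step C Q)
  have "smooth_on_open S (\<lambda>x. C ** f x + x *\<^sub>R (meval Q x ** f x))"
    using smooth_bounded_linear(1)[OF bounded_linear_matrix_mult_left f] smooth_mult_ident[OF step]
    by (rule smooth_add)
  then show ?case
    by (simp add: meval_add meval_xmul matrix_add_rdistrib matrix_mult_scaleR)
qed

text \<open>Two conjugate transposes turn the right factor into a left one, so
  \<open>smooth_meval\<close> handles both sides.\<close>

lemma smooth_sandwich:
  assumes f: "smooth_on_open S f"
  shows "smooth_on_open S (\<lambda>x. meval P x ** f x ** ctranspose (meval Q x))"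
proof -
  have "smooth_on_open S (\<lambda>x. ctranspose (meval Q x ** ctranspose (meval P x ** f x)))"
    using f by (intro smooth_bounded_linear(1)[OF bounded_linear_ctranspose] smooth_meval)
  then show ?thesis
    by (simp add: ctranspose_mult)
qed

lemma smooth_continuous_vderiv:
  "smooth_on_open S f \<Longrightarrow> continuous_on S (vderiv k f)"
  unfolding smooth_on_open_def
  by (intro differentiable_imp_continuous_on differentiable_at_imp_differentiable_on) blast

section \<open>Block matrices\<close>

definition blk :: "'a^'n^'n \<Rightarrow> 'a^'n^'n \<Rightarrow> 'a^'n^'n \<Rightarrow> 'a^'n^'n \<Rightarrow> 'a^('n + 'n)^('n + 'n)" where
  "blk A B C D = (\<chi> a b. case (a, b) of
      (Inl i, Inl j) \<Rightarrow> A $ i $ j | (Inl i, Inr j) \<Rightarrow> B $ i $ j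
    | (Inr i, Inl j) \<Rightarrow> C $ i $ j | (Inr i, Inr j) \<Rightarrow> D $ i $ j)"

lemma blk_nth [simp]:
  "blk A B C D $ Inl i $ Inl j = A $ i $ j" "blk A B C D $ Inl i $ Inr j = B $ i $ j"
  "blk A B C D $ Inr i $ Inl j = C $ i $ j" "blk A B C D $ Inr i $ Inr j = D $ i $ j"
  by (simp_all add: blk_def)

lemma blk_eq_iff:
  "M = N \<longleftrightarrow> (\<forall>i j. M $ Inl i $ Inl j = N $ Inl i $ Inl j \<and> M $ Inl i $ Inr j = N $ Inl i $ Inr j \<and>
     M $ Inr i $ Inl j = N $ Inr i $ Inl j \<and> M $ Inr i $ Inr j = N $ Inr i $ Inr j)"
  for M N :: "'a^(('n::finite) + 'n)^('n + 'n)"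
  by (auto simp: vec_eq_iff split_sum_all)

lemma blk_cases:
  obtains A B C D where "M = blk A B C D"
proof
  show "M = blk (\<chi> i j. M $ Inl i $ Inl j) (\<chi> i j. M $ Inl i $ Inr j)
      (\<chi> i j. M $ Inr i $ Inl j) (\<chi> i j. M $ Inr i $ Inr j)"
    by (simp add: blk_eq_iff)
qed

lemma blk_inject [simp]:
  "blk A B C D = blk A' B' C' D' \<longleftrightarrow> A = A' \<and> B = B' \<and> C = C' \<and> D = D'"
  by (auto simp: blk_eq_iff vec_eq_iff)

lemma blk_zero [simp]: "blk 0 0 0 0 = 0"
  by (simp add: blk_eq_iff)

lemma blk_one: "blk (mat 1) 0 0 (mat 1) = mat 1"
  by (simp add: blk_eq_iff mat_def)

lemma blk_add: "blk A B C D + blk A' B' C' D' = blk (A + A') (B + B') (C + C') (D + D')"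
  by (simp add: blk_eq_iff)

lemma blk_scaleR: "r *\<^sub>R blk A B C D = blk (r *\<^sub>R A) (r *\<^sub>R B) (r *\<^sub>R C) (r *\<^sub>R D)"
  by (simp add: blk_eq_iff)

lemma blk_sum:
  "(\<Sum>s\<in>S. blk (f s) (g s) (h s) (k s)) = blk (sum f S) (sum g S) (sum h S) (sum k S)"
  by (induction S rule: infinite_finite_induct) (simp_all add: blk_add)

lemma sum_UNIV_Plus:
  fixes f :: "('a::finite) + ('b::finite) \<Rightarrow> 'c::comm_monoid_add"
  shows "sum f UNIV = (\<Sum>a\<in>UNIV. f (Inl a)) + (\<Sum>b\<in>UNIV. f (Inr b))"
  by (simp add: UNIV_Plus_UNIV[symmetric] sum.Plus del: UNIV_Plus_UNIV)

lemma blk_mult: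
  fixes A :: "'a::semiring_1^'n^('n::finite)"
  shows "blk A B C D ** blk A' B' C' D'
    = blk (A ** A' + B ** C') (A ** B' + B ** D') (C ** A' + D ** C') (C ** B' + D ** D')"
  by (simp add: blk_eq_iff matrix_matrix_mult_def sum_UNIV_Plus)

lemma map_matrix_blk:
  "map_matrix f (blk A B C D) = blk (map_matrix f A) (map_matrix f B) (map_matrix f C) (map_matrix f D)"
  by (simp add: blk_eq_iff)

lemma meval_blk: "meval (blk A B C D) x = blk (meval A x) (meval B x) (meval C x) (meval D x)"
  by (simp add: meval_def map_matrix_blk)

lemma mderiv_blk: "mderiv k (blk A B C D) = blk (mderiv k A) (mderiv k B) (mderiv k C) (mderiv k D)"
  by (simp add: mderiv_def map_matrix_blk)

lemma ctranspose_blk: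
  "ctranspose (blk A B C D) = blk (ctranspose A) (ctranspose C) (ctranspose B) (ctranspose D)"
  by (simp add: blk_eq_iff)

lemma weight_sum_blk: "weight_sum W Wt x = blk (W x) 0 0 (Wt x)"
  by (simp add: blk_eq_iff weight_sum_def)

lemma invertible_blk:
  fixes A D :: "'a::semiring_1^'n^('n::finite)"
  assumes "invertible A" "invertible D"
  shows "invertible (blk A 0 0 D)"
  unfolding invertible_def
  by (rule exI[of _ "blk (matrix_inv A) 0 0 (matrix_inv D)"])
    (simp add: blk_mult matrix_inv_mult assms blk_one)

lemma bounded_linear_blk:
  fixes E :: "complex^'n^'n \<Rightarrow> complex^('n + 'n)^(('n::finite) + 'n)"
  assumes "\<And>X Y. E (X + Y) = E X + E Y" and "\<And>r X. E (r *\<^sub>R X) = r *\<^sub>R E X"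
  shows "bounded_linear E"
  using assms by (intro linear_conv_bounded_linear[THEN iffD1] linearI) simp_all

text \<open>With these embeddings, integrals and derivatives of block matrices are taken block by
  block.\<close>

lemma bounded_linear_blks:
  "bounded_linear (\<lambda>X :: complex^'n^('n::finite). blk X 0 0 0)"
  "bounded_linear (\<lambda>X :: complex^'n^('n::finite). blk 0 X 0 0)"
  "bounded_linear (\<lambda>X :: complex^'n^('n::finite). blk 0 0 X 0)"
  "bounded_linear (\<lambda>X :: complex^'n^('n::finite). blk 0 0 0 X)"
  by (rule bounded_linear_blk; simp add: blk_add blk_scaleR)+

lemma mint_blk:
  fixes f g h k :: "real \<Rightarrow> complex^'n^('n::finite)"
  assumes "set_integrable lborel (einterval x0 x1) f" "set_integrable lborel (einterval x0 x1) g"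
    "set_integrable lborel (einterval x0 x1) h" "set_integrable lborel (einterval x0 x1) k"
  shows "mint x0 x1 (\<lambda>x. blk (f x) (g x) (h x) (k x))
    = blk (mint x0 x1 f) (mint x0 x1 g) (mint x0 x1 h) (mint x0 x1 k)"
proof -
  note int = set_integrable_bounded_linear[OF bounded_linear_blks(1) assms(1)]
    set_integrable_bounded_linear[OF bounded_linear_blks(2) assms(2)]
    set_integrable_bounded_linear[OF bounded_linear_blks(3) assms(3)]
    set_integrable_bounded_linear[OF bounded_linear_blks(4) assms(4)]
  note eq = set_integral_bounded_linear[OF bounded_linear_blks(1) assms(1)]
    set_integral_bounded_linear[OF bounded_linear_blks(2) assms(2)]
    set_integral_bounded_linear[OF bounded_linear_blks(3) assms(3)]
    set_integral_bounded_linear[OF bounded_linear_blks(4) assms(4)]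
  have "mint x0 x1 (\<lambda>x. blk (f x) (g x) (h x) (k x))
      = mint x0 x1 (\<lambda>x. blk (f x) 0 0 0 + blk 0 (g x) 0 0 + blk 0 0 (h x) 0 + blk 0 0 0 (k x))"
    by (simp add: blk_add)
  also have "\<dots> = blk (mint x0 x1 f) 0 0 0 + blk 0 (mint x0 x1 g) 0 0 + blk 0 0 (mint x0 x1 h) 0
      + blk 0 0 0 (mint x0 x1 k)"
    by (simp add: mint_def set_integral_add int eq)
  finally show ?thesis
    by (simp add: blk_add)
qed

text \<open>An off-diagonal operator turns a relation between two inner products into an adjoint
  relation for the single weight \<open>weight_sum W Wt\<close>, to which the standing assumption
  applies.\<close>

definition upper_dop :: "('n::finite) dop \<Rightarrow> ('n + 'n) dop" where
  "upper_dop D = map_poly (\<lambda>F. blk 0 F 0 0) D"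

text \<open>The corner opposite to \<open>upper_dop\<close>, since conjugate transposition exchanges
  the off-diagonal blocks.\<close>

definition lower_dop :: "('n::finite) dop \<Rightarrow> ('n + 'n) dop" where
  "lower_dop D = map_poly (\<lambda>F. blk 0 0 F 0) D"

lemma coeff_upper_dop: "coeff (upper_dop D) i = blk 0 (coeff D i) 0 0"
  by (simp add: upper_dop_def coeff_map_poly)

lemma coeff_lower_dop: "coeff (lower_dop D) i = blk 0 0 (coeff D i) 0"
  by (simp add: lower_dop_def coeff_map_poly)

lemma act_upper_dop: "act (blk A B C E) (upper_dop D) = blk 0 (act A D) 0 (act C D)"
proof -
  have "degree (upper_dop D) \<le> degree D"
    by (rule degree_le) (simp add: coeff_upper_dop coeff_eq_0)
  then show ?thesis
    by (simp add: act_upto act_def[of _ D] coeff_upper_dop mderiv_blk blk_mult blk_sum)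
qed

lemma act_lower_dop: "act (blk A B C E) (lower_dop D) = blk (act B D) 0 (act E D) 0"
proof -
  have "degree (lower_dop D) \<le> degree D"
    by (rule degree_le) (simp add: coeff_lower_dop coeff_eq_0)
  then show ?thesis
    by (simp add: act_upto act_def[of _ D] coeff_lower_dop mderiv_blk blk_mult blk_sum)
qed

section \<open>The formal adjoint through the direct sum of the weights\<close>

context two_weights
begin

text \<open>Each of the four blocks is an instance of the hypothesis, applied to a block from the
  left column of \<open>P\<close> and one from the right column of \<open>Q\<close>.\<close>

lemma pairing_weight_sum:
  assumes N: "\<And>P Q. Wt.ip (act P V) Q = W.ip P (act Q N)"
  shows "pairing x0 x1 (weight_sum W Wt) (act P (upper_dop V)) Q
    = pairing x0 x1 (weight_sum W Wt) P (act Q (lower_dop N))"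
proof -
  obtain A B C E A' B' C' E' where "P = blk A B C E" "Q = blk A' B' C' E'"
    using blk_cases by metis
  then show ?thesis
    by (simp add: pairing_def act_upper_dop act_lower_dop weight_sum_blk meval_blk ctranspose_blk
        blk_mult mint_blk W.integrable Wt.integrable N[unfolded pairing_def])
qed

text \<open>On the direct sum, the adjoint relation puts \<open>N\<close> in the lower left corner of the formal
  adjoint of the operator with \<open>V\<close> in the upper right corner. This yields the formula for \<open>N\<close> only
  where both weights are invertible; the other points are reached by continuity, after
  multiplication by \<open>W\<close>.\<close>

lemma is_adjoint_of_adjoint:
  assumes good: "good_enough x0 x1 (weight_sum W Wt)"
    and N: "\<And>P Q. Wt.ip (act P V) Q = W.ip P (act Q N)"
  shows "is_adjoint x0 x1 W Wt V N"
proof -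
  let ?I = "einterval x0 x1" and ?S = "weight_sum W Wt"
  let ?f = "\<lambda>Q j t. meval Q t ** Wt t ** ctranspose (meval (coeff V j) t)"
  let ?H = "\<lambda>Q x. \<Sum>j\<le>degree V. (-1) ^ j *\<^sub>R vderiv j (?f Q j) x"
  have smooth: "smooth_on_open ?I W" "smooth_on_open ?I Wt"
    using W.weight Wt.weight by (simp_all add: weight_def)
  \<comment> \<open>\<open>adj_act\<close> sums up to the degree, so the exact degree is used; it is
    preserved because \<open>blk 0 F 0 0\<close> vanishes only for \<open>F = 0\<close>.\<close>
  have deg: "degree (upper_dop V) = degree V"
    unfolding upper_dop_def by (rule degree_map_poly) (simp flip: blk_zero)
  have adj: "is_adjoint x0 x1 ?S ?S (upper_dop V) (lower_dop N)"
    using good pairing_weight_sum[OF N] unfolding good_enough_def by blast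
  have both: "meval (act Q N) x ** W x = ?H Q x"
    if x: "x \<in> ?I" and inv: "invertible (W x)" "invertible (Wt x)" for Q x
  proof -
    have invS: "invertible (?S x)"
      using inv by (simp add: weight_sum_blk invertible_blk)
    \<comment> \<open>With \<open>Q\<close> in the lower right corner, everything is concentrated in
      the lower left block, where the identity for \<open>N\<close> is read off.\<close>
    have f: "meval (blk 0 0 0 Q) t ** ?S t ** ctranspose (meval (coeff (upper_dop V) j) t)
        = blk 0 0 (?f Q j t) 0" for t j
      by (simp add: coeff_upper_dop weight_sum_blk meval_blk ctranspose_blk blk_mult)
    have "vderiv j (\<lambda>t. blk 0 0 (?f Q j t) 0) x = blk 0 0 (vderiv j (?f Q j) x) 0" for j
      by (rule smooth_bounded_linear(2)[OF bounded_linear_blks(3) smooth_sandwich[OF smooth(2)] x])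
    then have "adj_act ?S ?S (upper_dop V) (blk 0 0 0 Q) x = blk 0 0 (?H Q x) 0 ** matrix_inv (?S x)"
      by (simp add: adj_act_def f deg blk_scaleR blk_sum)
    then have "meval (act (blk 0 0 0 Q) (lower_dop N)) x = blk 0 0 (?H Q x) 0 ** matrix_inv (?S x)"
      using adj x invS by (simp add: is_adjoint_def)
    then have "meval (act (blk 0 0 0 Q) (lower_dop N)) x ** ?S x = blk 0 0 (?H Q x) 0"
      by (simp add: matrix_mul_assoc[symmetric] matrix_inv_mult invS)
    then show ?thesis
      by (simp add: act_lower_dop meval_blk weight_sum_blk blk_mult)
  qed
  have all: "meval (act Q N) x ** W x = ?H Q x" if "x \<in> ?I" for Q x
  proof (rule AE_eq_on_open[OF open_einterval _ _ _ that])
    have "continuous_on ?I (vderiv 0 (\<lambda>x. meval (act Q N) x ** W x))"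
      by (intro smooth_continuous_vderiv smooth_meval smooth)
    then show "continuous_on ?I (\<lambda>x. meval (act Q N) x ** W x)"
      by simp
    show "continuous_on ?I (?H Q)"
      by (intro continuous_intros smooth_continuous_vderiv smooth_sandwich smooth)
    have "AE x in lborel. x \<in> ?I \<longrightarrow> pos_def (W x)" "AE x in lborel. x \<in> ?I \<longrightarrow> pos_def (Wt x)"
      using W.weight Wt.weight by (simp_all add: weight_def)
    then show "AE x in lborel. x \<in> ?I \<longrightarrow> meval (act Q N) x ** W x = ?H Q x"
      by eventually_elim (use both pos_def_invertible in blast)
  qed
  \<comment> \<open>\<open>all\<close> holds on the whole interval, so cancelling \<open>W x\<close>
    also covers points where \<open>Wt x\<close> is singular.\<close>
  have "adj_act W Wt V Q x = meval (act Q N) x ** (W x ** matrix_inv (W x))" if "x \<in> ?I" for Q x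
    unfolding adj_act_def all[OF that, symmetric] by (rule matrix_mul_assoc[symmetric])
  then show ?thesis
    unfolding is_adjoint_def by (simp add: matrix_inv_mult)
qed

end

theorem theorem3p3:
  fixes x0 x1 :: ereal
    and W Wt :: "real \<Rightarrow> complex^'n^'n"
    and P Pt :: "nat \<Rightarrow> ('n::finite) mpoly"
    and V :: "'n dop"
    and A :: "nat \<Rightarrow> complex^'n^'n"
  assumes "weight x0 x1 W" and "weight x0 x1 Wt"
    and "good_enough x0 x1 W" and "good_enough x0 x1 Wt" and "good_enough x0 x1 (weight_sum W Wt)"
    and "orthogonal_seq x0 x1 W P" and "orthogonal_seq x0 x1 Wt Pt"
    and "\<forall>n. act (P n) V = mconst (A n) ** Pt n"
    and "\<exists>n. invertible (A n)"
  shows "\<exists>(N :: 'n dop) (At :: nat \<Rightarrow> complex^'n^'n).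
      (\<forall>n. act (Pt n) N = mconst (At n) ** P n) \<and>
      (\<exists>n. invertible (At n)) \<and>
      (\<forall>n. act (P n) (dop_mult V N) = mconst (A n ** At n) ** P n) \<and>
      (\<forall>n. act (Pt n) (dop_mult N V) = mconst (At n ** A n) ** Pt n) \<and>
      dop_mult V N \<in> dop_algebra x0 x1 W \<and>
      dop_mult N V \<in> dop_algebra x0 x1 Wt \<and>
      is_adjoint x0 x1 W Wt V N"
proof -
  interpret darboux x0 x1 W Wt P Pt V A
    using assms by unfold_locales auto
  obtain N where adj: "\<And>P Q. Wt.ip (act P V) Q = W.ip P (act Q N)"
    and act_N: "\<And>n. act (Pt n) N = mconst (At n) ** P n"
    using adjoint_operator by blast
  \<comment> \<open>Left constants pass through operators, so \<open>A n\<close> comes out before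
    \<open>N\<close> acts on \<open>Pt n\<close>.\<close>
  have VN: "act (P n) (dop_mult V N) = mconst (A n ** At n) ** P n" for n
    by (simp add: act_dop_mult act_V act_N act_mconst_left mconst_mult matrix_mul_assoc)
  have NV: "act (Pt n) (dop_mult N V) = mconst (At n ** A n) ** Pt n" for n
    by (simp add: act_dop_mult act_V act_N act_mconst_left mconst_mult matrix_mul_assoc)
  have "dop_mult V N \<in> dop_algebra x0 x1 W"
    using assms(6) VN by (auto simp: dop_algebra_def)
  moreover have "dop_mult N V \<in> dop_algebra x0 x1 Wt"
    using assms(7) NV by (auto simp: dop_algebra_def)
  ultimately show ?thesis
    using act_N VN NV invertible_At assms(9) is_adjoint_of_adjoint[OF assms(5) adj] by blast
qed

end
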